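(* $[4]=4$. That is: let $n\ge 4$ and let $\mathcal{F}$ be any neutral fault of mass $4$ in $\mathcal{Q}_n$ (i.e. a set of two red and two green vertices). Then $\mathcal{Q}_n-\mathcal{F}$ is Hamiltonian. The claim is not true for $n=3$: there is a neutral fault $\mathcal{F}$ of mass $4$ in $\mathcal{Q}_3$ such that $\mathcal{Q}_3-\mathcal{F}$ is not Hamiltonian.
   Context: $\mathcal{Q}_n$ is the $n$-dimensional binary hypercube: its vertices are all binary sequences of length $n$, and two vertices are adjacent iff they differ in exactly one position. A vertex is even or odd according to the parity of its number of 1's; the vertices of one parity are called red and those of the other parity green. A fault $\mathcal{F}$ in $\mathcal{Q}_n$ is a set of deleted vertices; its mass is $|\mathcal{F}|$, its charge is the absolute value of the difference between the numbers of red and green vertices in $\mathcal{F}$, and it is neutral if its charge is $0$. $\mathcal{Q}_n-\mathcal{F}$ is the subgraph induced by the non-deleted vertices. A graph is Hamiltonian if it has a Hamiltonian cycle. For an even integer $M\ge 0$, $[M]$ denotes the smallest positive integer $m$ such that for every $n\ge m$ and every neutral fault $\mathcal{F}$ of mass $M$ in $\mathcal{Q}_n$ the graph $\mathcal{Q}_n-\mathcal{F}$ is Hamiltonian. *)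

theory Defs
  imports "Graph_Theory.Digraph_Component" "Graph_Theory.Pair_Digraph"
begin

text \<open>Undirected graphs are symmetric loop-free digraphs (locale \<^locale>\<open>graph\<close>): each edge is
  represented by its two opposite arcs.\<close>

definition hypercube :: "nat \<Rightarrow> (bool list, bool list \<times> bool list) pre_digraph" where
  "hypercube n = with_proj
     \<lparr> pverts = {v. length v = n},
       parcs = {(u, v). length u = n \<and> length v = n \<and> card {i. i < n \<and> u ! i \<noteq> v ! i} = 1} \<rparr>"

lemma graph_hypercube: "graph (hypercube n)"
proof -
  define V where "V = {v :: bool list. length v = n}"
  define A where "A = {(u :: bool list, v). length u = n \<and> length v = n \<and>
    card {i. i < n \<and> u ! i \<noteq> v ! i} = 1}"
  have A_sub: "A \<subseteq> V \<times> V"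
    unfolding A_def V_def by blast
  have fin_V: "finite V"
    unfolding V_def using finite_lists_length_eq[of "UNIV :: bool set" n] by simp
  have fin_A: "finite A"
    using finite_subset[OF A_sub] fin_V by blast
  have irrefl_A: "(u, u) \<notin> A" for u
    unfolding A_def by simp
  have sym_A: "sym A"
  proof (rule symI)
    fix u v assume "(u, v) \<in> A"
    moreover have "{i. i < n \<and> v ! i \<noteq> u ! i} = {i. i < n \<and> u ! i \<noteq> v ! i}"
      by (rule Collect_cong) metis
    ultimately show "(v, u) \<in> A"
      unfolding A_def mem_Collect_eq prod.case by metis
  qed
  have "pair_graph \<lparr> pverts = V, parcs = A \<rparr>"
    using A_sub fin_V fin_A irrefl_A sym_A
    by unfold_locales (auto simp: symmetric_def simp del: split_paired_All)
  then have "graph (with_proj \<lparr> pverts = V, parcs = A \<rparr>)"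
    by (rule pair_graph.pair_graphD_graph)
  then show ?thesis
    unfolding hypercube_def V_def A_def .
qed

text \<open>A cycle in the library's sense may run back and forth along a single edge; the length bound
  excludes this, since a cycle of an undirected graph has at least three vertices. The tails of the
  arcs of a cycle are exactly its vertices.\<close>

definition hamiltonian_cycle :: "('a, 'b) pre_digraph \<Rightarrow> 'b list \<Rightarrow> bool" where
  "hamiltonian_cycle G p \<longleftrightarrow>
     pre_digraph.cycle G p \<and> 3 \<le> length p \<and> tail G ` set p = verts G"

definition hamiltonian :: "('a, 'b) pre_digraph \<Rightarrow> bool" where
  "hamiltonian G \<longleftrightarrow> (\<exists>p. hamiltonian_cycle G p)"

text \<open>Calling the even vertices red is an arbitrary choice: the charge is symmetric in the two
  colours.\<close>

definition red :: "bool list \<Rightarrow> bool" where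
  "red v \<longleftrightarrow> even (count_list v True)"

abbreviation green :: "bool list \<Rightarrow> bool" where
  "green v \<equiv> \<not> red v"

definition fault :: "nat \<Rightarrow> bool list set \<Rightarrow> bool" where
  "fault n F \<longleftrightarrow> F \<subseteq> verts (hypercube n)"

definition mass :: "bool list set \<Rightarrow> nat" where
  "mass F = card F"

definition charge :: "bool list set \<Rightarrow> int" where
  "charge F = \<bar>int (card {v \<in> F. red v}) - int (card {v \<in> F. green v})\<bar>"

definition neutral :: "bool list set \<Rightarrow> bool" where
  "neutral F \<longleftrightarrow> charge F = 0"

definition faulty_hypercube ::
    "nat \<Rightarrow> bool list set \<Rightarrow> (bool list, bool list \<times> bool list) pre_digraph" where
  "faulty_hypercube n F = hypercube n \<restriction> (verts (hypercube n) - F)"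

text \<open>The number $[M]$; as usual for \<open>LEAST\<close>, its value is unspecified if no such \<open>m\<close> exists.\<close>

definition hamiltonian_threshold :: "nat \<Rightarrow> nat" where
  "hamiltonian_threshold M = (LEAST m. 0 < m \<and>
     (\<forall>n\<ge>m. \<forall>F. fault n F \<and> neutral F \<and> mass F = M \<longrightarrow> hamiltonian (faulty_hypercube n F)))"

end

theory Submission
  imports Defs
begin

text \<open>
  The proof cuts the cube along a coordinate \<open>k\<close> into two opposite facets, finds a Hamiltonian path
  in what the fault leaves of each of them, and joins the two paths by edges in direction \<open>k\<close>.
  Flipping one coordinate changes the colour of a vertex, so an edge in direction \<open>k\<close> joins vertices
  of different colours; counting colours then tells which endpoints are possible on each side.

  Four facts about a subcube are used. Any two vertices of different colours are the ends of a
  Hamiltonian path (\<open>ham_path_subcube\<close>). If one vertex is deleted, any two distinct vertices of the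
  other colour are the ends of one (\<open>ham_path_minus_vertex\<close>). If one red and one green vertex are
  deleted, the rest has a Hamiltonian cycle through every remaining edge that is not parallel to an
  edge between the deleted vertices (\<open>ham_path_minus_pair_along_edge\<close>). If, in dimension three or more,
  three vertices are deleted, one of colour \<open>c\<close> and two of the other colour, the rest has a Hamiltonian
  path whose ends have colour \<open>c\<close> (\<open>ham_path_minus_triple\<close>). Only the first two need induction; each of
  the others follows from one cut that separates deleted vertices.

  Now let the fault consist of \<open>r1\<close>, \<open>r2\<close> of one colour and \<open>g1\<close>, \<open>g2\<close> of the other, and cut along a
  coordinate in which \<open>r1\<close> and \<open>r2\<close> differ. If \<open>g1\<close> and \<open>g2\<close> fall on the same side, that side has lost
  three vertices and the other one, and the fourth and the second fact give two paths that
  close up to a cycle. Otherwise each side has lost one vertex of each colour. It suffices to find an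
  edge of one side such that the edge and its copy on the other side both qualify for the third fact:
  two cycles through parallel edges merge into one. For \<open>n \<ge> 5\<close> there is such an edge by counting. For
  \<open>n = 4\<close> the counting fails only if \<open>r2\<close> and \<open>g2\<close> are the antipodes of \<open>r1\<close> and \<open>g1\<close> and \<open>r1\<close>,
  \<open>g1\<close> are adjacent; in that case a cut along the direction of the edge between \<open>r1\<close> and \<open>g1\<close> works.

  For \<open>n = 3\<close> the deletion of two opposite parallel edges leaves two disjoint edges.
\<close>

section \<open>Subcubes\<close>

definition flip :: "nat \<Rightarrow> bool list \<Rightarrow> bool list" where
  "flip k v = v[k := \<not> v ! k]"

definition adjacent :: "bool list \<Rightarrow> bool list \<Rightarrow> bool" where
  "adjacent u v \<longleftrightarrow> (\<exists>k<length u. v = flip k u)"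

text \<open>The set \<open>S\<close> consists of the free coordinates; the list \<open>b\<close> fixes the values of the others. Both
  sides of a cut of a subcube are subcubes again, and the results below hold for all of them, so no
  isomorphism with a smaller cube is ever needed.\<close>
definition subcube :: "nat set \<Rightarrow> bool list set \<Rightarrow> bool" where
  "subcube S V \<longleftrightarrow> (\<exists>b. S \<subseteq> {..<length b} \<and>
     V = {v. length v = length b \<and> (\<forall>i<length b. i \<notin> S \<longrightarrow> v ! i = b ! i)})"

definition side :: "nat \<Rightarrow> bool \<Rightarrow> bool list set \<Rightarrow> bool list set" where
  "side k b V = {v \<in> V. v ! k = b}"

lemma length_flip [simp]: "length (flip k v) = length v"
  by (simp add: flip_def)

lemma flip_flip [simp]: "flip k (flip k v) = v"
  by (cases "k < length v") (simp_all add: flip_def list_update_beyond)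

lemma flip_eq_iff [simp]: "flip k u = flip k v \<longleftrightarrow> u = v"
  by (metis flip_flip)

lemma flip_commute: "flip j (flip k v) = flip k (flip j v)"
  by (cases "j = k") (simp_all add: flip_def list_update_swap)

lemma nth_flip: "k < length v \<Longrightarrow> flip k v ! i = (if i = k then \<not> v ! k else v ! i)"
  by (simp add: flip_def nth_list_update)

lemma red_flip: "k < length v \<Longrightarrow> red (flip k v) \<longleftrightarrow> \<not> red v"
proof (induction v arbitrary: k)
  case (Cons x v)
  then show ?case
    by (cases k) (auto simp: red_def flip_def)
qed simp

lemma adjacent_red: "adjacent u v \<Longrightarrow> red v \<longleftrightarrow> \<not> red u"
  by (auto simp: adjacent_def red_flip)

lemma adjacent_sym: "adjacent u v \<Longrightarrow> adjacent v u"
  unfolding adjacent_def by (metis flip_flip length_flip)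

context
  fixes S V
  assumes cube: "subcube S V"
begin

lemma subcube_length: "v \<in> V \<Longrightarrow> k \<in> S \<Longrightarrow> k < length v"
  using cube by (auto simp: subcube_def)

lemma finite_dims: "finite S"
  using cube finite_subset by (auto simp: subcube_def)

lemma flip_in: "v \<in> V \<Longrightarrow> k \<in> S \<Longrightarrow> flip k v \<in> V"
  using cube subcube_length[of v k] by (auto simp: subcube_def nth_flip split: if_splits)

lemma flip_nth: "v \<in> V \<Longrightarrow> k \<in> S \<Longrightarrow> flip k v ! i = (if i = k then \<not> v ! k else v ! i)"
  by (rule nth_flip[OF subcube_length])

lemma flip_red: "v \<in> V \<Longrightarrow> k \<in> S \<Longrightarrow> red (flip k v) \<longleftrightarrow> \<not> red v"
  by (rule red_flip[OF subcube_length])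

lemma flip_adjacent: "v \<in> V \<Longrightarrow> k \<in> S \<Longrightarrow> adjacent v (flip k v)"
  using subcube_length by (auto simp: adjacent_def)

lemma subcube_eqI: "u \<in> V \<Longrightarrow> v \<in> V \<Longrightarrow> (\<And>i. i \<in> S \<Longrightarrow> u ! i = v ! i) \<Longrightarrow> u = v"
  using cube unfolding subcube_def by (smt (verit, best) mem_Collect_eq nth_equalityI)

lemma differing_coordinate:
  assumes "u \<in> V" "v \<in> V" "u \<noteq> v"
  obtains k where "k \<in> S" "u ! k \<noteq> v ! k"
  using assms subcube_eqI by blast

lemma subcube_side:
  assumes "k \<in> S"
  shows "subcube (S - {k}) (side k b V)"
proof -
  obtain a where a: "S \<subseteq> {..<length a}"
    "V = {v. length v = length a \<and> (\<forall>i<length a. i \<notin> S \<longrightarrow> v ! i = a ! i)}"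
    using cube by (auto simp: subcube_def)
  have "k < length a"
    using a(1) assms by auto
  then have "side k b V = {v. length v = length (a[k := b]) \<and>
      (\<forall>i<length (a[k := b]). i \<notin> S - {k} \<longrightarrow> v ! i = a[k := b] ! i)}"
    using assms by (auto simp: side_def a(2) nth_list_update)
  then show ?thesis
    unfolding subcube_def using a(1) by (intro exI[of _ "a[k := b]"]) auto
qed

lemma flip_side: "k \<in> S \<Longrightarrow> v \<in> side k b V \<Longrightarrow> flip k v \<in> side k (\<not> b) V"
  using flip_in flip_nth by (auto simp: side_def)

end

lemma mem_side [simp]: "v \<in> side k b V \<longleftrightarrow> v \<in> V \<and> v ! k = b"
  by (simp add: side_def)

lemma side_disjoint: "side k b V \<inter> side k (\<not> b) V = {}"
  by auto

lemma card_subcube: "subcube S V \<Longrightarrow> finite V \<and> card V = 2 ^ card S"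
proof (induction "card S" arbitrary: S V)
  case 0
  then have "S = {}"
    using finite_dims by fastforce
  then obtain b where "V = {v. length v = length b \<and> (\<forall>i<length b. v ! i = b ! i)}"
    using 0 by (auto simp: subcube_def)
  then have "V = {b}"
    by (auto intro: nth_equalityI)
  then show ?case
    using \<open>S = {}\<close> by simp
next
  case (Suc m)
  then obtain k where k: "k \<in> S"
    by fastforce
  have m: "m = card (S - {k})"
    using Suc k finite_dims by simp
  note IH = Suc(1)[OF m subcube_side[OF Suc(3) k]]
  have "V = side k True V \<union> side k False V"
    by auto
  moreover have "card (side k True V \<union> side k False V) = 2 ^ m + 2 ^ m"
    using IH m side_disjoint[of k True V] by (subst card_Un_disjoint) auto
  ultimately show ?case
    using IH Suc(2) by (metis finite_UnI mult_2 power_Suc)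
qed

lemma subcube_UNIV: "subcube {..<n} {v. length v = n}"
  unfolding subcube_def by (rule exI[of _ "replicate n True"]) auto

section \<open>Hamiltonian paths\<close>

text \<open>The set \<open>V\<close> is arbitrary, so that deleted vertices are expressed by a set difference. A
  Hamiltonian cycle of \<open>V\<close> through the edge \<open>xy\<close> is a path \<open>ham_path V x y\<close> with \<open>adjacent x y\<close>.\<close>
definition ham_path :: "bool list set \<Rightarrow> bool list \<Rightarrow> bool list \<Rightarrow> bool" where
  "ham_path V x y \<longleftrightarrow> (\<exists>p. p \<noteq> [] \<and> distinct p \<and> set p = V \<and> successively adjacent p \<and>
     hd p = x \<and> last p = y)"

lemma ham_path_single: "ham_path {x} x x"
  unfolding ham_path_def by (rule exI[of _ "[x]"]) simp

lemma ham_path_in: "ham_path V x y \<Longrightarrow> x \<in> V \<and> y \<in> V"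
  unfolding ham_path_def by (metis hd_in_set last_in_set)

lemma ham_path_rev: "ham_path V x y \<Longrightarrow> ham_path V y x"
  unfolding ham_path_def
proof (elim exE)
  fix p assume "p \<noteq> [] \<and> distinct p \<and> set p = V \<and> successively adjacent p \<and> hd p = x \<and> last p = y"
  moreover have "successively adjacent (rev p)" if "successively adjacent p"
    using that unfolding successively_rev
    by (rule successively_mono) (auto intro: adjacent_sym)
  ultimately show "\<exists>p. p \<noteq> [] \<and> distinct p \<and> set p = V \<and> successively adjacent p \<and> hd p = y \<and> last p = x"
    by (intro exI[of _ "rev p"]) (auto simp: hd_rev last_rev)
qed

lemma ham_path_join:
  assumes "ham_path A x y" "ham_path B u v" "adjacent y u" "A \<inter> B = {}" "V = A \<union> B"
  shows "ham_path V x v"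
proof -
  obtain p q where "p \<noteq> []" "distinct p" "set p = A" "successively adjacent p" "hd p = x" "last p = y"
    "q \<noteq> []" "distinct q" "set q = B" "successively adjacent q" "hd q = u" "last q = v"
    using assms(1,2) unfolding ham_path_def by blast
  then show ?thesis
    unfolding ham_path_def using assms(3-5)
    by (intro exI[of _ "p @ q"]) (auto simp: successively_append_iff)
qed

text \<open>The deletion of an inner vertex leaves two paths; they are to be joined again by a detour through
  another part of the cube.\<close>
lemma ham_path_cut:
  assumes "ham_path A x y" "r \<in> A" "r \<noteq> x" "r \<noteq> y"
  obtains B C u v where "A - {r} = B \<union> C" "B \<inter> C = {}" "adjacent u r" "adjacent r v"
    "ham_path B x u" "ham_path C v y"
proof -
  obtain p where p: "p \<noteq> []" "distinct p" "set p = A" "successively adjacent p" "hd p = x" "last p = y"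
    using assms(1) unfolding ham_path_def by blast
  obtain xs ys where s: "p = xs @ r # ys"
    using assms(2) p(3) by (metis split_list)
  then have ne: "xs \<noteq> []" "ys \<noteq> []"
    using p(5,6) assms(3,4) by auto
  have adj: "adjacent (last xs) r" "adjacent r (hd ys)" "successively adjacent xs" "successively adjacent ys"
    using p(4) ne by (auto simp: s successively_append_iff successively_Cons)
  show ?thesis
  proof (rule that[of "set xs" "set ys" "last xs" "hd ys"])
    show "ham_path (set xs) x (last xs)" "ham_path (set ys) (hd ys) y"
      unfolding ham_path_def using p ne adj by (auto simp: s)
  qed (use p adj s in auto)
qed


section \<open>Laceability\<close>

text \<open>A cut along a coordinate in which \<open>x\<close> and \<open>y\<close> differ reduces the claim to both sides: the path
  starts at \<open>x\<close>, crosses once, at any vertex \<open>w\<close> whose colour is not that of \<open>x\<close>, and ends at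
  \<open>y\<close>.\<close>
lemma ham_path_subcube:
  assumes "subcube S V" "x \<in> V" "y \<in> V" "red x \<noteq> red y"
  shows "ham_path V x y"
  using assms
proof (induction "card S" arbitrary: S V x y rule: less_induct)
  case less
  note cube = less.prems(1)
  obtain k where k: "k \<in> S" "x ! k \<noteq> y ! k"
    using differing_coordinate less.prems by metis
  let ?A = "side k (x ! k) V" and ?B = "side k (\<not> x ! k) V"
  have sub: "subcube (S - {k}) ?A" "subcube (S - {k}) ?B"
    using subcube_side[OF cube k(1)] by auto
  have card: "card (S - {k}) < card S"
    using k(1) finite_dims[OF cube] by (intro card_Diff1_less)
  have x: "x \<in> ?A" and y: "y \<in> ?B"
    using less.prems k(2) by auto
  have V: "V = ?A \<union> ?B"
    by auto
  show ?case
  proof (cases "S = {k}")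
    case True
    \<comment> \<open>The subcube is a single edge.\<close>
    have A: "?A = {x}" and B: "?B = {y}"
      using subcube_eqI[OF sub(1) _ x] subcube_eqI[OF sub(2) _ y] x y True by blast+
    have "flip k x = y"
      using flip_side[OF cube k(1) x] unfolding B by simp
    then have "adjacent x y"
      using flip_adjacent[OF cube less.prems(2) k(1)] by simp
    then show ?thesis
      using ham_path_join[OF ham_path_single[of x] ham_path_single[of y] _ _ V[unfolded A B]]
        less.prems(4) by auto
  next
    case False
    then obtain j where j: "j \<in> S - {k}"
      using k(1) by blast
    define w where "w = flip j x"
    have w: "w \<in> ?A" "red w \<noteq> red x"
      unfolding w_def using flip_in[OF sub(1) x j] flip_red[OF sub(1) x j] by auto
    have w': "flip k w \<in> ?B" "red (flip k w) = red x" "adjacent w (flip k w)"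
      using flip_side[OF cube k(1) w(1)] flip_red[OF cube _ k(1)] flip_adjacent[OF cube _ k(1)] w
      by auto
    have "ham_path ?A x w"
      using less.hyps[OF card sub(1) x w(1)] w(2) by simp
    moreover have "ham_path ?B (flip k w) y"
      using less.hyps[OF card sub(2) w'(1) y] w'(2) less.prems(4) by simp
    ultimately show ?thesis
      by (rule ham_path_join) (use w'(3) in auto)
  qed
qed

text \<open>In dimension one the start \<open>u\<close> is the only vertex left and has to be the end as well; in higher
  dimensions there is another vertex of the same colour. The premise \<open>path\<close> is what
  \<open>ham_path_minus_vertex\<close> provides; it is a premise here because the induction step of that lemma needs
  the present statement for a facet.\<close>
lemma ham_path_minus_vertex_from_ends:
  assumes cube: "subcube S V" and r: "r \<in> V" and u: "u \<in> V" "red u \<noteq> red r"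
    and path: "\<And>v. v \<in> V \<Longrightarrow> v \<noteq> u \<Longrightarrow> red v = red u \<Longrightarrow> ham_path (V - {r}) u v"
  obtains v where "v \<in> V" "red v = red u" "ham_path (V - {r}) u v"
proof -
  obtain i where i: "i \<in> S"
    using differing_coordinate[OF cube r u(1)] u(2) by blast
  show ?thesis
  proof (cases "S = {i}")
    case True
    then have "card V = 2" "finite V"
      using card_subcube[OF cube] by auto
    moreover have "r \<noteq> u"
      using u(2) by auto
    ultimately have "V = {r, u}"
      using card_seteq[of V "{r, u}"] r u(1) by simp
    then have "V - {r} = {u}"
      using u by auto
    then show ?thesis
      using that[of u] ham_path_single u by simp
  next
    case False
    then obtain j where j: "j \<in> S" "j \<noteq> i"
      using i by blast
    define v where "v = flip j (flip i u)"
    have "v \<in> V" "red v = red u" "v ! i \<noteq> u ! i"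
      unfolding v_def using i j u(1) by (simp_all add: flip_in[OF cube] flip_red[OF cube] flip_nth[OF cube])
    then show ?thesis
      using that path by metis
  qed
qed

text \<open>The cut separates \<open>u\<close> and \<open>v\<close>. On the side of \<open>r\<close> the path covers everything but \<open>r\<close>, by
  induction; the other side is intact, and there \<open>ham_path_subcube\<close> applies.\<close>
lemma ham_path_minus_vertex:
  assumes "subcube S V" "r \<in> V" "u \<in> V" "v \<in> V" "u \<noteq> v" "red u \<noteq> red r" "red v \<noteq> red r"
  shows "ham_path (V - {r}) u v"
  using assms
proof (induction "card S" arbitrary: S V r u v rule: less_induct)
  case less
  note cube = less.prems(1)
  obtain k where k: "k \<in> S" "u ! k \<noteq> v ! k"
    using differing_coordinate less.prems by metis
  have card: "card (S - {k}) < card S"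
    using k(1) finite_dims[OF cube] by (intro card_Diff1_less)
  have main: "ham_path (V - {r}) a b"
    if ab: "a \<in> V" "b \<in> V" "a ! k \<noteq> b ! k" "red a \<noteq> red r" "red b \<noteq> red r" and rk: "r ! k = a ! k" for a b
  proof -
    let ?A = "side k (a ! k) V" and ?B = "side k (\<not> a ! k) V"
    have sub: "subcube (S - {k}) ?A" "subcube (S - {k}) ?B"
      using subcube_side[OF cube k(1)] by auto
    have mem: "r \<in> ?A" "a \<in> ?A" "b \<in> ?B"
      using ab rk less.prems by auto
    obtain w where w: "w \<in> ?A" "red w = red a" "ham_path (?A - {r}) a w"
    proof (rule ham_path_minus_vertex_from_ends[OF sub(1) mem(1,2) ab(4)])
      show "ham_path (?A - {r}) a c" if "c \<in> ?A" "c \<noteq> a" "red c = red a" for c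
        using less.hyps[OF card sub(1) mem(1,2) that(1)] that ab(4) by auto
    qed
    have w': "flip k w \<in> ?B" "red (flip k w) = red r" "adjacent w (flip k w)"
      using flip_side[OF cube k(1) w(1)] flip_red[OF cube _ k(1)] flip_adjacent[OF cube _ k(1)] w ab
      by auto
    have "ham_path ?B (flip k w) b"
      using ham_path_subcube[OF sub(2) w'(1) mem(3)] w'(2) ab by auto
    then show ?thesis
      by (rule ham_path_join[OF w(3) _ w'(3)]) (use mem in auto)
  qed
  show ?case
  proof (cases "r ! k = u ! k")
    case True
    then show ?thesis
      using main[of u v] k less.prems by blast
  next
    case False
    then have "ham_path (V - {r}) v u"
      using main[of v u] k less.prems by auto
    then show ?thesis
      by (rule ham_path_rev)
  qed
qed

lemma ham_path_minus_vertex_from: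
  assumes "subcube S V" "r \<in> V" "u \<in> V" "red u \<noteq> red r"
  obtains v where "v \<in> V" "red v = red u" "ham_path (V - {r}) u v"
proof (rule ham_path_minus_vertex_from_ends[OF assms])
  show "ham_path (V - {r}) u w" if "w \<in> V" "w \<noteq> u" "red w = red u" for w
    using ham_path_minus_vertex[OF assms(1-3) that(1)] that assms(4) by auto
qed

section \<open>Two or three deleted vertices\<close>

text \<open>Since \<open>g\<close> is not the neighbour of \<open>r\<close> in direction \<open>j\<close>, some coordinate \<open>k \<noteq> j\<close> separates \<open>r\<close> from
  \<open>g\<close>, and the edge \<open>st\<close> lies on one side of the cut along \<open>k\<close>. The deleted vertex on that side is an
  inner vertex of a Hamiltonian path of the side from \<open>s\<close> to \<open>t\<close>. Its two neighbours on the path are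
  connected by a detour that covers the other side except for the second deleted vertex. The
  condition on \<open>j\<close> cannot be dropped: in dimension three, if \<open>r\<close> and \<open>g\<close> are adjacent, the rest has only
  one Hamiltonian cycle, a hexagon that misses the edge antipodal to \<open>rg\<close>.\<close>
lemma ham_path_minus_pair_along_edge:
  assumes cube: "subcube S V" and r: "r \<in> V" and g: "g \<in> V" and rg: "red r \<noteq> red g"
    and j: "j \<in> S" "flip j r \<noteq> g"
    and s: "s \<in> V" "s \<noteq> r" "s \<noteq> g" and t: "t = flip j s" "t \<noteq> r" "t \<noteq> g"
  shows "ham_path (V - {r, g}) s t"
proof -
  obtain k where k: "k \<in> S" "k \<noteq> j" "r ! k \<noteq> g ! k"
  proof (rule ccontr)
    assume "\<not> thesis"
    then have agree: "r ! i = g ! i" if "i \<in> S" "i \<noteq> j" for i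
      using that \<open>\<And>k. k \<in> S \<Longrightarrow> k \<noteq> j \<Longrightarrow> r ! k \<noteq> g ! k \<Longrightarrow> thesis\<close> by blast
    have "r \<noteq> g"
      using rg by auto
    then have "r ! j \<noteq> g ! j"
      using subcube_eqI[OF cube r g] agree by metis
    then have "flip j r = g"
      using agree flip_nth[OF cube r j(1)] by (intro subcube_eqI[OF cube flip_in[OF cube r j(1)] g]) auto
    then show False
      using j(2) by simp
  qed
  let ?A = "side k (s ! k) V" and ?B = "side k (\<not> s ! k) V"
  have sub: "subcube (S - {k}) ?A" "subcube (S - {k}) ?B"
    using subcube_side[OF cube k(1)] by auto
  have st: "s \<in> ?A" "t \<in> ?A" "red s \<noteq> red t"
    using s t j k flip_in[OF cube] flip_nth[OF cube] flip_red[OF cube] by auto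
  have main: "ham_path (V - {a, b}) s t"
    if ab: "a \<in> ?A" "b \<in> ?B" "red a \<noteq> red b" "s \<noteq> a" "t \<noteq> a" for a b
  proof -
    obtain B C u v where cut: "?A - {a} = B \<union> C" "B \<inter> C = {}" "adjacent u a" "adjacent a v"
      "ham_path B s u" "ham_path C v t"
      using ham_path_cut[OF ham_path_subcube[OF sub(1) st] ab(1)] ab(4,5) by metis
    have uv: "u \<in> B" "v \<in> C" "red u \<noteq> red a" "red v \<noteq> red a"
      using ham_path_in[OF cut(5)] ham_path_in[OF cut(6)] adjacent_red[OF cut(3)] adjacent_red[OF cut(4)]
      by auto
    have BC: "B \<subseteq> ?A" "C \<subseteq> ?A"
      using equalityD2[OF cut(1)] by blast+
    then have uvA: "u \<in> ?A" "v \<in> ?A" "u \<noteq> v"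
      using uv(1,2) cut(2) by blast+
    have fl: "flip k u \<in> ?B" "flip k v \<in> ?B" "red (flip k u) = red a" "red (flip k v) = red a"
      "adjacent u (flip k u)" "adjacent (flip k v) v"
      using flip_side[OF cube k(1)] flip_red[OF cube _ k(1)] flip_adjacent[OF cube _ k(1)]
        adjacent_sym[of v "flip k v"] uvA uv
      by auto
    have "ham_path (?B - {b}) (flip k u) (flip k v)"
      using ham_path_minus_vertex[OF sub(2) ab(2) fl(1,2)] fl(3,4) uvA(3) ab(3) by auto
    then have detour: "ham_path ((?B - {b}) \<union> C) (flip k u) t"
      by (rule ham_path_join[OF _ cut(6) fl(6)]) (use BC in auto)
    have disj: "B \<inter> ?B = {}"
      using BC by auto
    have "V - {a, b} = (?A - {a}) \<union> (?B - {b})"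
      using ab(1,2) by auto
    then have "V - {a, b} = B \<union> ((?B - {b}) \<union> C)"
      unfolding cut(1) by (simp add: Un_ac)
    then show ?thesis
      using cut(2) disj by (intro ham_path_join[OF cut(5) detour fl(5)]) blast+
  qed
  show ?thesis
  proof (cases "r ! k = s ! k")
    case True
    then show ?thesis
      using main[of r g] k r g rg s t by auto
  next
    case False
    then have "ham_path (V - {g, r}) s t"
      using main[of g r] k r g rg s t by auto
    then show ?thesis
      by (simp add: insert_commute)
  qed
qed

text \<open>This covers dimension two, where the only edge left may be parallel to \<open>rg\<close>, so that the previous
  lemma does not apply; in return, only the colours of the ends are prescribed.\<close>
lemma ham_path_minus_pair:
  assumes cube: "subcube S V" and S: "2 \<le> card S" and r: "r \<in> V" and g: "g \<in> V" and rg: "red r \<noteq> red g"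
  obtains s t where "s \<in> V" "t \<in> V" "red s = red r" "red t = red g" "ham_path (V - {r, g}) s t"
proof -
  obtain k where k: "k \<in> S" "r ! k \<noteq> g ! k"
    using differing_coordinate[OF cube r g] rg by metis
  let ?A = "side k (r ! k) V" and ?B = "side k (\<not> r ! k) V"
  have sub: "subcube (S - {k}) ?A" "subcube (S - {k}) ?B"
    using subcube_side[OF cube k(1)] by auto
  have "S \<noteq> {k}" using S by auto
  then obtain j where j: "j \<in> S - {k}"
    using k(1) by blast
  have rA: "r \<in> ?A" and gB: "g \<in> ?B"
    using r g k by auto
  define v where "v = flip j r"
  have v: "v \<in> ?A" "red v \<noteq> red r"
    unfolding v_def using flip_in[OF sub(1) rA j] flip_red[OF sub(1) rA j] by auto
  have v': "flip k v \<in> ?B" "red (flip k v) \<noteq> red g" "adjacent v (flip k v)"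
    using flip_side[OF cube k(1) v(1)] flip_red[OF cube _ k(1)] flip_adjacent[OF cube _ k(1)] v rg
    by auto
  obtain t where t: "t \<in> ?A" "red t = red v" "ham_path (?A - {r}) v t"
    using ham_path_minus_vertex_from[OF sub(1) rA v] by blast
  obtain s where s: "s \<in> ?B" "red s = red (flip k v)" "ham_path (?B - {g}) (flip k v) s"
    using ham_path_minus_vertex_from[OF sub(2) gB v'(1,2)] by blast
  have "ham_path (V - {r, g}) t s"
    by (rule ham_path_join[OF ham_path_rev[OF t(3)] s(3) v'(3)]) (use rA gB in auto)
  then show thesis
    using that[of s t] ham_path_rev s t v v' rg by auto
qed

text \<open>The cut separates \<open>g\<close> from \<open>h\<close>. The side that contains \<open>r\<close> has lost a pair, the other side a single
  vertex.\<close>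
lemma ham_path_minus_triple:
  assumes cube: "subcube S V" and S: "3 \<le> card S" and r: "r \<in> V" and g: "g \<in> V" "h \<in> V" "g \<noteq> h"
    and col: "red g \<noteq> red r" "red h \<noteq> red r"
  obtains y w where "y \<in> V" "w \<in> V" "y \<noteq> w" "red y = red r" "red w = red r" "ham_path (V - {r, g, h}) y w"
proof -
  obtain k where k: "k \<in> S" "g ! k \<noteq> h ! k"
    using differing_coordinate[OF cube g] by metis
  have main: "\<exists>y w. y \<in> V \<and> w \<in> V \<and> y \<noteq> w \<and> red y = red r \<and> red w = red r \<and> ham_path (V - {r, a, b}) y w"
    if ab: "a \<in> V" "b \<in> V" "a ! k \<noteq> b ! k" "r ! k = a ! k" "red a \<noteq> red r" "red b \<noteq> red r" for a b
  proof -
    let ?A = "side k (a ! k) V" and ?B = "side k (\<not> a ! k) V"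
    have sub: "subcube (S - {k}) ?A" "subcube (S - {k}) ?B"
      using subcube_side[OF cube k(1)] by auto
    have S': "2 \<le> card (S - {k})"
      using S k(1) finite_dims[OF cube] by simp
    have mem: "r \<in> ?A" "a \<in> ?A" "b \<in> ?B"
      using ab r by auto
    obtain s t where st: "s \<in> ?A" "t \<in> ?A" "red s = red r" "red t = red a" "ham_path (?A - {r, a}) s t"
      using ham_path_minus_pair[OF sub(1) S' mem(1,2)] ab(5) by metis
    have t': "flip k t \<in> ?B" "red (flip k t) \<noteq> red b" "adjacent t (flip k t)"
      using flip_side[OF cube k(1) st(2)] flip_red[OF cube _ k(1)] flip_adjacent[OF cube _ k(1)] st ab
      by auto
    obtain w where w: "w \<in> ?B" "red w = red (flip k t)" "ham_path (?B - {b}) (flip k t) w"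
      using ham_path_minus_vertex_from[OF sub(2) mem(3) t'(1,2)] by blast
    have "ham_path (V - {r, a, b}) s w"
      by (rule ham_path_join[OF st(5) w(3) t'(3)]) (use mem in auto)
    then show ?thesis
      using st w t' ab by (intro exI[of _ s] exI[of _ w]) auto
  qed
  show thesis
  proof (cases "r ! k = g ! k")
    case True
    then show thesis
      using main[of g h] that k g col by blast
  next
    case False
    have "{r, h, g} = {r, g, h}" by auto
    then show thesis
      using main[of h g] that k g col False by metis
  qed
qed


section \<open>Four deleted vertices\<close>

text \<open>The edges in direction \<open>j\<close> form a perfect matching, so each vertex of \<open>F\<close> spoils one of them.\<close>
lemma edge_avoiding:
  assumes cube: "subcube S V" and j: "j \<in> S" and F: "finite F" "2 * card F < 2 ^ card S"
  obtains a where "a \<in> V" "a \<notin> F" "flip j a \<notin> F"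
proof (rule ccontr)
  assume "\<not> thesis"
  then have "V \<subseteq> F \<union> flip j ` F"
    using that by (metis UnCI flip_flip image_eqI subsetI)
  then have "card V \<le> card (F \<union> flip j ` F)"
    using F(1) by (intro card_mono) auto
  also have "\<dots> \<le> card F + card (flip j ` F)"
    by (rule card_Un_le)
  also have "card (flip j ` F) \<le> card F"
    using F(1) by (rule card_image_le)
  finally show False
    using F card_subcube[OF cube] by simp
qed

text \<open>The cycles of the two sides run through the edge at \<open>a\<close> in direction \<open>j\<close> and through its copy. Both
  edges are replaced by the two edges in direction \<open>k\<close> between them.\<close>
lemma ham_cycle_of_parallel_edges:
  assumes cube: "subcube S V" and k: "k \<in> S"
    and r1: "r1 \<in> side k b V" and g1: "g1 \<in> side k b V" and c1: "red r1 \<noteq> red g1"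
    and r2: "r2 \<in> side k (\<not> b) V" and g2: "g2 \<in> side k (\<not> b) V" and c2: "red r2 \<noteq> red g2"
    and j: "j \<in> S - {k}" "flip j r1 \<noteq> g1" "flip j r2 \<noteq> g2"
    and a: "a \<in> side k b V" and avoid: "{a, flip j a} \<inter> {r1, g1, flip k r2, flip k g2} = {}"
  shows "\<exists>x y. adjacent x y \<and> ham_path (V - {r1, r2, g1, g2}) x y"
proof -
  let ?A = "side k b V" and ?B = "side k (\<not> b) V"
  have sub: "subcube (S - {k}) ?A" "subcube (S - {k}) ?B"
    using subcube_side[OF cube k] by auto
  define s where "s = flip k (flip j a)"
  have ja: "flip j a \<in> ?A"
    using flip_in[OF sub(1) a j(1)] .
  have sB: "s \<in> ?B" "flip k a \<in> ?B" "flip k a = flip j s"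
    unfolding s_def using flip_side[OF cube k ja] flip_side[OF cube k a] flip_commute[of j k] by simp_all
  have "ham_path (?A - {r1, g1}) a (flip j a)"
    by (rule ham_path_minus_pair_along_edge[OF sub(1) r1 g1 c1 j(1,2) a]) (use avoid in auto)
  moreover have "s \<noteq> r2" "s \<noteq> g2" "flip k a \<noteq> r2" "flip k a \<noteq> g2"
    unfolding s_def using avoid by auto
  then have "ham_path (?B - {r2, g2}) s (flip k a)"
    by (intro ham_path_minus_pair_along_edge[OF sub(2) r2 g2 c2 j(1,3) sB(1) _ _ sB(3)])
  moreover have "adjacent (flip j a) s"
    unfolding s_def using flip_adjacent[OF cube _ k] ja by simp
  ultimately have "ham_path (V - {r1, r2, g1, g2}) a (flip k a)"
    by (rule ham_path_join) (use r1 r2 g1 g2 in auto)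
  then show ?thesis
    using flip_adjacent[OF cube _ k] a by auto
qed

text \<open>Besides \<open>k\<close> at most two directions \<open>j\<close> are excluded, one for each pair of deleted vertices. In an
  admissible direction a side has \<open>2 ^ (card S - 2)\<close> edges, which has to exceed the number of vertices
  to be avoided. There are at most four of those, and this suffices in dimension five or more; in
  dimension four, two of them have to coincide.\<close>
lemma ham_cycle_split_pairs_with_room:
  assumes cube: "subcube S V" and S: "4 \<le> card S" and k: "k \<in> S"
    and r1: "r1 \<in> side k b V" and g1: "g1 \<in> side k b V" and c1: "red r1 \<noteq> red g1"
    and r2: "r2 \<in> side k (\<not> b) V" and g2: "g2 \<in> side k (\<not> b) V" and c2: "red r2 \<noteq> red g2"
    and few: "5 \<le> card S \<or> card {r1, g1, flip k r2, flip k g2} \<le> 3"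
  shows "\<exists>x y. adjacent x y \<and> ham_path (V - {r1, r2, g1, g2}) x y"
proof -
  have unique: "i = i'" if "flip i v = flip i' v" "v \<in> V" "i \<in> S" "i' \<in> S" for i i' v
    using that(1) flip_nth[OF cube that(2,3), of i'] flip_nth[OF cube that(2,4), of i'] by metis
  have fin: "finite S"
    using finite_dims[OF cube] .
  let ?D = "\<lambda>v w. {i \<in> S. flip i v = w}"
  have D: "card (?D v w) \<le> 1" if "v \<in> V" for v w
  proof -
    have "\<forall>i\<in>?D v w. \<forall>i'\<in>?D v w. i = i'"
      using unique[OF _ that] by simp
    then show ?thesis
      using fin card_le_Suc0_iff_eq[of "?D v w"] by simp
  qed
  have "card (insert k (?D r1 g1 \<union> ?D r2 g2)) \<le> Suc (card (?D r1 g1 \<union> ?D r2 g2))"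
    by (rule card_insert_le_m1) simp_all
  also have "\<dots> \<le> Suc (card (?D r1 g1) + card (?D r2 g2))"
    using card_Un_le by simp
  also have "\<dots> < card S"
    using D[of r1 g1] D[of r2 g2] r1 r2 S by simp
  finally have "\<not> S \<subseteq> insert k (?D r1 g1 \<union> ?D r2 g2)"
    using fin card_mono[of "insert k (?D r1 g1 \<union> ?D r2 g2)" S] by auto
  then obtain j where j: "j \<in> S - {k}" "flip j r1 \<noteq> g1" "flip j r2 \<noteq> g2"
    by blast
  let ?F = "{r1, g1, flip k r2, flip k g2}"
  have "card ?F \<le> 4"
    by (simp add: card_insert_if)
  then have "2 * card ?F < 2 ^ card (S - {k})"
  proof (cases "5 \<le> card S")
    case True
    then have "(2::nat) ^ 4 \<le> 2 ^ card (S - {k})"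
      using k fin by (intro power_increasing) auto
    then show ?thesis
      using \<open>card ?F \<le> 4\<close> by simp
  next
    case False
    then have "card (S - {k}) = 3"
      using S k fin by simp
    then show ?thesis
      using few False by simp
  qed
  then obtain a where "a \<in> side k b V" "a \<notin> ?F" "flip j a \<notin> ?F"
    using edge_avoiding[OF subcube_side[OF cube k] j(1), of ?F b] by blast
  then show ?thesis
    by (intro ham_cycle_of_parallel_edges[OF cube k r1 g1 c1 r2 g2 c2 j]) auto
qed


text \<open>In the three-dimensional cube, vertices of different colours have distance one or three.\<close>
lemma antipodal_of_not_adjacent:
  assumes cube: "subcube S V" and S: "card S = 3" and x: "x \<in> V" and y: "y \<in> V"
    and col: "red x \<noteq> red y" and nadj: "\<And>i. i \<in> S \<Longrightarrow> flip i x \<noteq> y"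
    and i: "i \<in> S"
  shows "x ! i \<noteq> y ! i"
proof
  assume eq: "x ! i = y ! i"
  have "card (S - {i}) = 2"
    using S i finite_dims[OF cube] by simp
  then obtain a b where ab: "S - {i} = {a, b}" "a \<noteq> b"
    by (auto simp: card_2_iff)
  then have S: "S = {i, a, b}" "a \<noteq> i" "b \<noteq> i"
    using i by auto
  define z where "z = (if x ! a = y ! a then if x ! b = y ! b then x else flip b x
    else if x ! b = y ! b then flip a x else flip a (flip b x))"
  have "z = y"
    unfolding z_def using x S ab(2) eq flip_in[OF cube] flip_nth[OF cube]
    by (intro subcube_eqI[OF cube _ y]) auto
  then show False
    using col nadj[of a] nadj[of b] S x flip_in[OF cube] flip_red[OF cube]
    unfolding z_def by (auto split: if_splits)
qed

text \<open>The remaining case is dimension four. Let \<open>p\<close> and \<open>q\<close> be the copies of \<open>g2\<close> and \<open>r2\<close> on the side of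
  \<open>r1\<close> and \<open>g1\<close>, so that \<open>p\<close> has the colour of \<open>r1\<close> and \<open>q\<close> that of \<open>g1\<close>. If no suitable edge exists,
  then in each admissible direction the four edges of the side in that direction contain \<open>r1\<close>, \<open>g1\<close>, \<open>p\<close>, \<open>q\<close>, one each.
  In particular no edge in such a direction joins two of them. An edge between \<open>r1\<close> and \<open>q\<close>
  in an excluded direction is impossible too: there the neighbour of \<open>r1\<close> is \<open>g1 \<noteq> q\<close>, or the
  neighbour of \<open>q\<close> is \<open>p \<noteq> r1\<close>. So \<open>q\<close> is the antipode of \<open>r1\<close>, and likewise \<open>p\<close> that of \<open>g1\<close>; hence \<open>g1\<close> is not
  the antipode of \<open>r1\<close> but a neighbour, in some direction \<open>z\<close>. The cut along \<open>z\<close> puts \<open>r1\<close> and \<open>g2\<close> on one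
  side and \<open>r2\<close> and \<open>g1\<close> on the other, and now two of the vertices to be avoided coincide,
  because \<open>flip z g1 = r1\<close>.\<close>
lemma ham_cycle_split_pairs:
  assumes cube: "subcube S V" and S: "4 \<le> card S" and k: "k \<in> S"
    and r1: "r1 \<in> side k b V" and g1: "g1 \<in> side k b V" and c1: "red r1 \<noteq> red g1"
    and r2: "r2 \<in> side k (\<not> b) V" and g2: "g2 \<in> side k (\<not> b) V" and c2: "red r2 = red r1" "red g2 = red g1"
  shows "\<exists>x y. adjacent x y \<and> ham_path (V - {r1, r2, g1, g2}) x y"
proof (rule ccontr)
  assume contra: "\<not> ?thesis"
  let ?A = "side k b V"
  have sub: "subcube (S - {k}) ?A"
    using subcube_side[OF cube k] .
  define p q where "p = flip k g2" and "q = flip k r2"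
  have pq: "p \<in> ?A" "q \<in> ?A" "red p = red r1" "red q = red g1"
    unfolding p_def q_def using flip_side[OF cube k r2] flip_side[OF cube k g2] flip_red[OF cube _ k] r2 g2 c1 c2
    by auto
  have c2': "red r2 \<noteq> red g2" "red q \<noteq> red p"
    using c1 c2 pq by auto
  have "\<not> (5 \<le> card S \<or> card {r1, g1, q, p} \<le> 3)"
    using ham_cycle_split_pairs_with_room[OF cube S k r1 g1 c1 r2 g2 c2'(1)] contra
    unfolding p_def q_def by blast
  then have large: "\<not> 5 \<le> card S" "3 < card {r1, g1, q, p}"
    by auto
  then have card3: "card (S - {k}) = 3"
    using S k finite_dims[OF cube] by simp
  have distinct: "r1 \<noteq> p" "g1 \<noteq> q"
    using large(2) by (auto simp: card_insert_if insert_commute split: if_splits)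
  have no_edge: "flip j x \<noteq> y"
    if j: "j \<in> S - {k}" "flip j r1 \<noteq> g1" "flip j p \<noteq> q" and xy: "x \<in> {r1, p}" "y \<in> {g1, q}" for j x y
  proof
    assume edge: "flip j x = y"
    \<comment> \<open>An edge in direction \<open>j\<close> that contains \<open>y\<close> also contains \<open>x\<close>, so \<open>y\<close> need not be avoided
      separately.\<close>
    let ?F = "{r1, g1, q, p} - {y}"
    have "card {r1, g1, q, p} \<le> 4"
      by (simp add: card_insert_if)
    then have "card ?F \<le> 3"
      using xy(2) by (subst card_Diff_singleton) auto
    then have "2 * card ?F < 2 ^ card (S - {k})"
      using card3 by simp
    then obtain a where a: "a \<in> ?A" "a \<notin> ?F" "flip j a \<notin> ?F"
      using edge_avoiding[OF sub j(1), of ?F] by blast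
    have "red x \<noteq> red y"
      using xy pq c1 by auto
    then have "x \<in> ?F"
      using xy(1) by auto
    then have "a \<noteq> y" "flip j a \<noteq> y"
      using a(2,3) edge flip_flip[of j] by metis+
    then have avoid: "{a, flip j a} \<inter> {r1, g1, flip k r2, flip k g2} = {}"
      using a(2,3) by (auto simp: p_def q_def)
    have "flip j r2 \<noteq> g2"
      using j(3) flip_flip[of j] flip_commute[of j k] unfolding p_def q_def by metis
    then show False
      using ham_cycle_of_parallel_edges[OF cube k r1 g1 c1 r2 g2 c2'(1) j(1,2) _ a(1) avoid] contra by simp
  qed
  have nadj: "flip j r1 \<noteq> q" "flip j g1 \<noteq> p" if j: "j \<in> S - {k}" for j
    using no_edge[OF j, of r1 q] no_edge[OF j, of p g1] distinct flip_flip[of j] by (metis insertCI)+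
  have opp: "r1 ! i \<noteq> q ! i" "g1 ! i \<noteq> p ! i" if "i \<in> S - {k}" for i
    using antipodal_of_not_adjacent[OF sub card3 r1 pq(2) _ nadj(1) that]
      antipodal_of_not_adjacent[OF sub card3 g1 pq(1) _ nadj(2) that] pq c1 by auto
  obtain z where z: "z \<in> S - {k}" "flip z r1 = g1"
  proof (rule ccontr)
    assume "\<not> thesis"
    then have "r1 ! i \<noteq> g1 ! i" if "i \<in> S - {k}" for i
      using antipodal_of_not_adjacent[OF sub card3 r1 g1 c1 _ that]
        \<open>\<And>z. z \<in> S - {k} \<Longrightarrow> flip z r1 = g1 \<Longrightarrow> thesis\<close> by blast
    then have "g1 = q"
      using opp by (intro subcube_eqI[OF sub g1 pq(2)]) auto
    then show False
      using distinct by simp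
  qed
  have zk: "z \<in> S" "z \<noteq> k"
    using z by auto
  have nth: "g1 ! z \<noteq> r1 ! z" "r2 ! z = q ! z" "g2 ! z = p ! z"
    using z(2) flip_nth[OF cube _ zk(1), of r1] flip_nth[OF cube _ k, of r2] flip_nth[OF cube _ k, of g2]
      r1 r2 g2 zk(2) by (auto simp: p_def q_def)
  let ?b = "r1 ! z"
  have sides: "r1 \<in> side z ?b V" "g2 \<in> side z ?b V" "r2 \<in> side z (\<not> ?b) V" "g1 \<in> side z (\<not> ?b) V"
    using nth opp[OF z(1)] r1 g1 r2 g2 by auto
  have "flip z g1 = r1"
    using z(2) flip_flip by metis
  then have "{r1, g2, flip z r2, flip z g1} = {r1, g2, flip z r2}"
    by auto
  then have "card {r1, g2, flip z r2, flip z g1} \<le> 3"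
    by (simp add: card_insert_if)
  then have "\<exists>x y. adjacent x y \<and> ham_path (V - {r1, r2, g2, g1}) x y"
    by (intro ham_cycle_split_pairs_with_room[OF cube S zk(1) sides(1,2) _ sides(3,4)]) (use c1 c2 in auto)
  then show False
    using contra by (simp add: insert_commute)
qed


text \<open>The path on the side of the three deleted vertices has its ends \<open>y\<close> and \<open>w\<close> in the colour of
  \<open>r2\<close>. Their copies on the other side have the colour that \<open>r1\<close> does not have, and so they are the ends of a
  Hamiltonian path of that side without \<open>r1\<close>.\<close>
lemma ham_cycle_split_single:
  assumes cube: "subcube S V" and S: "4 \<le> card S" and k: "k \<in> S"
    and r1: "r1 \<in> side k b V" and r2: "r2 \<in> side k (\<not> b) V"
    and g: "g1 \<in> side k (\<not> b) V" "g2 \<in> side k (\<not> b) V" "g1 \<noteq> g2"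
    and c: "red r2 = red r1" "red g1 \<noteq> red r1" "red g2 \<noteq> red r1"
  shows "\<exists>x y. adjacent x y \<and> ham_path (V - {r1, r2, g1, g2}) x y"
proof -
  let ?A = "side k b V" and ?B = "side k (\<not> b) V"
  have sub: "subcube (S - {k}) ?A" "subcube (S - {k}) ?B"
    using subcube_side[OF cube k] by auto
  have S': "3 \<le> card (S - {k})"
    using S k finite_dims[OF cube] by simp
  obtain y w where yw: "y \<in> ?B" "w \<in> ?B" "y \<noteq> w" "red y = red r2" "red w = red r2"
    "ham_path (?B - {r2, g1, g2}) y w"
    using ham_path_minus_triple[OF sub(2) S' r2 g] c by metis
  have fl: "flip k y \<in> ?A" "flip k w \<in> ?A" "red (flip k y) \<noteq> red r1" "red (flip k w) \<noteq> red r1"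
    "adjacent y (flip k y)" "adjacent w (flip k w)"
    using flip_side[OF cube k yw(1)] flip_side[OF cube k yw(2)] flip_red[OF cube _ k] flip_adjacent[OF cube _ k]
      yw c(1) by auto
  have "ham_path (?A - {r1}) (flip k w) (flip k y)"
    using ham_path_minus_vertex[OF sub(1) r1 fl(2,1)] fl(3,4) yw(3) by simp
  then have "ham_path (V - {r1, r2, g1, g2}) y (flip k y)"
    by (rule ham_path_join[OF yw(6) _ fl(6)]) (use r1 r2 g in auto)
  then show ?thesis
    using fl(5) by blast
qed

text \<open>A coordinate in which \<open>r1\<close> and \<open>r2\<close> differ leaves only the two kinds of cuts treated above.\<close>
lemma ham_cycle_minus_two_pairs:
  assumes cube: "subcube S V" and S: "4 \<le> card S"
    and mem: "r1 \<in> V" "r2 \<in> V" "g1 \<in> V" "g2 \<in> V" and ne: "r1 \<noteq> r2" "g1 \<noteq> g2"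
    and c: "red r2 = red r1" "red g1 \<noteq> red r1" "red g2 \<noteq> red r1"
  shows "\<exists>x y. adjacent x y \<and> ham_path (V - {r1, r2, g1, g2}) x y"
proof -
  obtain k where k: "k \<in> S" "r1 ! k \<noteq> r2 ! k"
    using differing_coordinate[OF cube mem(1,2) ne(1)] .
  have swap: "{r2, r1, g1, g2} = {r1, r2, g1, g2}" "{r1, r2, g2, g1} = {r1, r2, g1, g2}"
    by auto
  consider "g1 ! k = r1 ! k" "g2 ! k = r2 ! k" | "g1 ! k = r2 ! k" "g2 ! k = r1 ! k"
    | "g1 ! k = r2 ! k" "g2 ! k = r2 ! k" | "g1 ! k = r1 ! k" "g2 ! k = r1 ! k"
    using k(2) by (metis (full_types))
  then show ?thesis
  proof cases
    case 1
    then show ?thesis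
      using ham_cycle_split_pairs[OF cube S k(1), of r1 "r1 ! k" g1 r2 g2] mem c k(2) by auto
  next
    case 2
    then show ?thesis
      using ham_cycle_split_pairs[OF cube S k(1), of r1 "r1 ! k" g2 r2 g1] mem c k(2) swap by auto
  next
    case 3
    then show ?thesis
      using ham_cycle_split_single[OF cube S k(1), of r1 "r1 ! k" r2 g1 g2] mem c k(2) ne by auto
  next
    case 4
    then show ?thesis
      using ham_cycle_split_single[OF cube S k(1), of r2 "r2 ! k" r1 g1 g2] mem c k(2) ne swap by auto
  qed
qed

section \<open>Faulty hypercubes\<close>

lemma hypercube_simps:
  "verts (hypercube n) = {v. length v = n}"
  "arcs (hypercube n) = {(u, v). length u = n \<and> length v = n \<and> card {i. i < n \<and> u ! i \<noteq> v ! i} = 1}"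
  "tail (hypercube n) = fst" "head (hypercube n) = snd"
  by (simp_all add: hypercube_def)

lemma adjacent_arc:
  assumes "adjacent u v" "length u = n"
  shows "(u, v) \<in> arcs (hypercube n)"
proof -
  obtain k where k: "k < n" "v = flip k u"
    using assms by (auto simp: adjacent_def)
  then have "{i. i < n \<and> u ! i \<noteq> v ! i} = {k}"
    using assms(2) by (auto simp: nth_flip)
  then show ?thesis
    using k(2) assms(2) by (simp add: hypercube_simps)
qed

lemma cas_of_vertex_list:
  assumes "tail G = fst" "head G = snd" "xs \<noteq> []"
  shows "pre_digraph.cas G (hd xs) (zip xs (tl xs @ [z])) z"
  using assms(3)
proof (induction xs)
  case (Cons x xs)
  then show ?case
    using assms by (cases xs) (simp_all add: pre_digraph.cas.simps)
qed simp

lemma hamiltonianI: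
  assumes path: "ham_path ({v. length v = n} - F) x y" and adj: "adjacent x y"
    and card: "3 \<le> card ({v. length v = n} - F)"
  shows "hamiltonian (faulty_hypercube n F)"
proof -
  let ?G = "faulty_hypercube n F" and ?V = "{v. length v = n} - F"
  have G: "verts ?G = ?V" "tail ?G = fst" "head ?G = snd"
    "arcs ?G = {e \<in> arcs (hypercube n). fst e \<in> ?V \<and> snd e \<in> ?V}"
    by (simp_all add: faulty_hypercube_def hypercube_simps)
  obtain xs where xs: "xs \<noteq> []" "distinct xs" "set xs = ?V" "successively adjacent xs" "hd xs = x" "last xs = y"
    using path unfolding ham_path_def by blast
  let ?p = "zip xs (tl xs @ [x])"
  have len: "length (tl xs @ [x]) = length xs"
    using xs(1) by simp
  have heads: "set (tl xs @ [x]) = ?V" "distinct (tl xs @ [x])"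
    using xs by (cases xs; auto)+
  have cyc: "successively adjacent (xs @ [x])"
    using xs adj by (auto simp: successively_append_iff intro: adjacent_sym)
  have adj_nth: "adjacent (xs ! i) ((tl xs @ [x]) ! i)" if "i < length xs" for i
    using successively_nth[OF cyc, of i] that xs(1) by (cases xs) (auto simp: nth_append nth_Cons split: nat.splits)
  have "e \<in> arcs (hypercube n)" if "e \<in> set ?p" for e
  proof -
    obtain i where i: "i < length ?p" "?p ! i = e"
      using \<open>e \<in> set ?p\<close> unfolding in_set_conv_nth by blast
    then have "i < length xs" "e = (xs ! i, (tl xs @ [x]) ! i)"
      using len by (simp_all del: length_append length_tl)
    moreover have "length (xs ! i) = n"
      using nth_mem[OF calculation(1)] xs(3) by auto
    ultimately show ?thesis
      using adj_nth adjacent_arc by blast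
  qed
  moreover have "fst e \<in> ?V \<and> snd e \<in> ?V" if "e \<in> set ?p" for e
    using that xs(3) heads(1) by (metis prod.collapse set_zip_leftD set_zip_rightD)
  ultimately have arcs: "set ?p \<subseteq> arcs ?G"
    unfolding G by blast
  have cas: "pre_digraph.cas ?G x ?p x"
    using cas_of_vertex_list[OF G(2,3) xs(1), of x] xs(5) by simp
  have "x \<in> verts ?G"
    using xs G(1) by (metis hd_in_set)
  then have "pre_digraph.awalk ?G x ?p x"
    unfolding pre_digraph.awalk_def using arcs cas by blast
  moreover have "?p \<noteq> []"
    using xs(1) len by (cases xs) auto
  moreover have "map snd ?p = tl xs @ [x]" "map fst ?p = xs"
    using len by simp_all
  then have "tl (pre_digraph.awalk_verts ?G x ?p) = tl xs @ [x]" "fst ` set ?p = ?V"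
    using pre_digraph.awalk_verts_conv'[OF cas] G(3) \<open>?p \<noteq> []\<close> xs(3) by (simp_all flip: set_map)
  moreover have "length ?p = card ?V"
    using len distinct_card[OF xs(2)] xs(3) by simp
  ultimately have "hamiltonian_cycle ?G ?p"
    unfolding hamiltonian_cycle_def pre_digraph.cycle_def using heads(2) card G(1,2) by auto
  then show ?thesis
    unfolding hamiltonian_def by blast
qed

lemma hamiltonian_of_neutral_mass_4:
  assumes n: "4 \<le> n" and F: "fault n F" "neutral F" "mass F = 4"
  shows "hamiltonian (faulty_hypercube n F)"
proof -
  let ?V = "{v :: bool list. length v = n}"
  have cube: "subcube {..<n} ?V"
    by (rule subcube_UNIV)
  have FV: "F \<subseteq> ?V"
    using F(1) by (simp add: fault_def hypercube_simps)
  have fin: "finite F"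
    using F(3) by (simp add: mass_def card_ge_0_finite)
  have "F = {v \<in> F. red v} \<union> {v \<in> F. green v}"
    by auto
  then have "4 = card {v \<in> F. red v} + card {v \<in> F. green v}"
    using F(3) fin card_Un_disjoint[of "{v \<in> F. red v}" "{v \<in> F. green v}"] by (auto simp: mass_def)
  moreover have "card {v \<in> F. red v} = card {v \<in> F. green v}"
    using F(2) by (simp add: neutral_def charge_def)
  ultimately have "card {v \<in> F. red v} = 2" "card {v \<in> F. green v} = 2"
    by simp_all
  then obtain r1 r2 g1 g2 where rg: "{v \<in> F. red v} = {r1, r2}" "r1 \<noteq> r2"
    "{v \<in> F. green v} = {g1, g2}" "g1 \<noteq> g2"
    by (auto simp: card_2_iff)
  then have col: "red r1" "red r2" "green g1" "green g2" and F_eq: "F = {r1, r2, g1, g2}"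
    by blast+
  obtain x y where xy: "adjacent x y" "ham_path (?V - F) x y"
    using ham_cycle_minus_two_pairs[OF cube, of r1 r2 g1 g2] n FV col rg(2,4) unfolding F_eq by auto
  have "(2::nat) ^ 4 \<le> 2 ^ n"
    using n by (intro power_increasing) auto
  then have "3 \<le> card (?V - F)"
    using card_subcube[OF cube] FV fin F(3) by (simp add: card_Diff_subset mass_def)
  then show ?thesis
    using hamiltonianI xy by blast
qed

lemma head_last_of_cas:
  "pre_digraph.cas G u p v \<Longrightarrow> p \<noteq> [] \<Longrightarrow> head G (last p) = v"
  by (induction p arbitrary: u) (auto simp: pre_digraph.cas.simps)

text \<open>This is where the length bound on Hamiltonian cycles enters: a cycle with at least three arcs does
  not turn back after its first arc.\<close>
lemma hamiltonian_consecutive_arcs: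
  assumes "hamiltonian G"
  obtains e f where "e \<in> arcs G" "f \<in> arcs G" "head G e = tail G f" "head G f \<noteq> tail G e"
proof -
  obtain p u where p: "pre_digraph.awalk G u p u" "distinct (tl (pre_digraph.awalk_verts G u p))" "3 \<le> length p"
    using assms by (auto simp: hamiltonian_def hamiltonian_cycle_def pre_digraph.cycle_def)
  then obtain e f g q where q: "p = e # f # g # q"
    by (auto simp: numeral_3_eq_3 Suc_le_length_iff)
  have cas: "pre_digraph.cas G u p u" and arcs: "set p \<subseteq> arcs G"
    using p(1) by (simp_all add: pre_digraph.awalk_def)
  then have ends: "tail G e = u" "head G e = tail G f" "head G (last (g # q)) = u"
    using head_last_of_cas[OF cas] by (auto simp: q pre_digraph.cas.simps)
  have "distinct (map (head G) p)"
    using p(2) pre_digraph.awalk_verts_conv'[OF cas] by (simp add: q)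
  then have "head G f \<notin> head G ` set (g # q)"
    by (simp add: q)
  then have "head G f \<noteq> u"
    using ends(3) last_in_set[of "g # q"] by (metis image_eqI list.distinct(1))
  then show ?thesis
    using that[of e f] arcs ends by (simp add: q)
qed

lemma not_hamiltonian_cube_minus_four:
  obtains F where "fault 3 F" "neutral F" "mass F = 4" "\<not> hamiltonian (faulty_hypercube 3 F)"
proof
  \<comment> \<open>The vertices that remain are those whose first two entries agree. They form two disjoint edges in
    the direction of the last entry, so a walk can only go back and forth.\<close>
  let ?F = "{v :: bool list. length v = 3 \<and> v ! 0 \<noteq> v ! 1}"
  show "fault 3 ?F"
    by (auto simp: fault_def hypercube_simps)
  have F: "?F = {[True, False, False], [True, False, True], [False, True, False], [False, True, True]}"
    by (auto simp: numeral_3_eq_3 length_Suc_conv)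
  show "mass ?F = 4"
    unfolding mass_def F by simp
  have "{v \<in> ?F. red v} = {[True, False, True], [False, True, True]}"
    "{v \<in> ?F. green v} = {[True, False, False], [False, True, False]}"
    unfolding F by (auto simp: red_def)
  then show "neutral ?F"
    by (simp add: neutral_def charge_def)
  let ?G = "faulty_hypercube 3 ?F"
  have arc: "v = flip 2 u" if "(u, v) \<in> arcs ?G" for u v
  proof -
    have uv: "length u = 3" "length v = 3" "u ! 0 = u ! 1" "v ! 0 = v ! 1"
      "card {i. i < 3 \<and> u ! i \<noteq> v ! i} = 1"
      using that by (auto simp: faulty_hypercube_def hypercube_simps)
    then obtain k where k: "{i. i < 3 \<and> u ! i \<noteq> v ! i} = {k}"
      by (auto simp: card_1_singleton_iff)
    then have differ: "u ! i \<noteq> v ! i \<longleftrightarrow> i = k" if "i < 3" for i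
      using that by blast
    have "k < 3"
      using k by blast
    have "k \<noteq> 0" "k \<noteq> 1"
      using uv(3,4) differ[of 0] differ[of 1] by auto
    then have "k = 2"
      using \<open>k < 3\<close> by simp
    have "v ! i = flip 2 u ! i" if "i < 3" for i
      using differ[OF that] uv(1) by (auto simp: nth_flip \<open>k = 2\<close>)
    then show ?thesis
      using uv(1,2) by (simp add: nth_equalityI)
  qed
  show "\<not> hamiltonian ?G"
  proof
    assume "hamiltonian ?G"
    then obtain e f where ef: "e \<in> arcs ?G" "f \<in> arcs ?G" "snd e = fst f" "snd f \<noteq> fst e"
      by (rule hamiltonian_consecutive_arcs) (auto simp: faulty_hypercube_def hypercube_simps)
    then have "snd e = flip 2 (fst e)" "snd f = flip 2 (fst f)"
      using arc[of "fst e" "snd e"] arc[of "fst f" "snd f"] unfolding prod.collapse by blast+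
    then show False
      using ef(3,4) flip_flip by metis
  qed
qed

theorem lemma3p8:
  shows "hamiltonian_threshold 4 = 4 \<and>
    (\<forall>n\<ge>4. \<forall>F. fault n F \<and> neutral F \<and> mass F = 4 \<longrightarrow> hamiltonian (faulty_hypercube n F)) \<and>
    (\<exists>F. fault 3 F \<and> neutral F \<and> mass F = 4 \<and> \<not> hamiltonian (faulty_hypercube 3 F))"
proof -
  obtain F where F: "fault 3 F" "neutral F" "mass F = 4" "\<not> hamiltonian (faulty_hypercube 3 F)"
    using not_hamiltonian_cube_minus_four by blast
  have "hamiltonian_threshold 4 = 4"
    unfolding hamiltonian_threshold_def
  proof (rule Least_equality)
    show "4 \<le> m" if "0 < m \<and>
      (\<forall>n\<ge>m. \<forall>F. fault n F \<and> neutral F \<and> mass F = 4 \<longrightarrow> hamiltonian (faulty_hypercube n F))" for m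
    proof (rule ccontr)
      assume "\<not> 4 \<le> m"
      then have "m \<le> 3" by simp
      then show False
        using that F by blast
    qed
  qed (use hamiltonian_of_neutral_mass_4 in auto)
  then show ?thesis
    using hamiltonian_of_neutral_mass_4 F by blast
qed

end
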